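(* Let $X$ and $Y$ be nonseparable Banach spaces belonging to the class $\mathcal E_0$, and let $f:B_{X^\ast}\to B_{Y^\ast}$ be a weak$^\ast$-to-weak$^\ast$ homeomorphism between their dual closed unit balls. If $(x_n^\ast)$ is a sequence in $B_{X^\ast}$ which weak$^\ast$ converges to $x^\ast$ and $\|x_n^\ast\|\to\|x^\ast\|$, then $\|f(x_n^\ast)\|\to\|f(x^\ast)\|$.
   Context: Compact spaces are Hausdorff. For a compact space $K$, $\mathcal Q(K)$ is the set of all Hausdorff quotient spaces $L=K/E$ ($E$ an equivalence relation on $K$, quotient topology), each with its canonical projection $p_L:K\to L$. It is ordered by: $L\le L'$ iff there is a continuous surjection $q:L'\to L$ (the natural projection) with $q\,p_{L'}=p_L$; equivalently, the equivalence relation of $L'$ is contained in that of $L$. Suprema in $\mathcal Q(K)$ correspond to intersections of equivalence relations. $\mathcal Q_\omega(K)\subset\mathcal Q(K)$ is the set of quotients of countable weight. A family $\mathcal S\subset\mathcal Q_\omega(K)$ is cofinal if for every $L\in\mathcal Q_\omega(K)$ there is $L'\in\mathcal S$ with $L\le L'$; it is a $\sigma$-semilattice if the supremum of every countable subset of $\mathcal S$ belongs to $\mathcal S$. Given a continuous surjection $\pi:M\to N$, a sequence $(x_n)$ in $N$ converging to $x\in N$ is called $\pi$-fiber convergent if for every $y\in\pi^{-1}(x)$ there are $y_n\in\pi^{-1}(x_n)$ with $y_n\to y$. If $K$ is a compact space of uncountable weight and $(x_n)$ is a sequence in $K$ converging to $x\in K$, then $(x_n)$ is called fiber convergent if there is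 a cofinal $\sigma$-semilattice $\mathcal S\subset\mathcal Q_\omega(K)$ such that for all $L'\le L$ in $\mathcal S$, with natural projection $\pi:L\to L'$, the sequence $(p_{L'}(x_n))_n$ (which converges to $p_{L'}(x)$) is $\pi$-fiber convergent. A nonseparable Banach space $X$ belongs to the class $\mathcal E_0$ if the fiber convergent sequences of $(B_{X^\ast},w^\ast)$ are exactly those sequences $(x_n^\ast)$ in $B_{X^\ast}$ that are weak$^\ast$ convergent to a point $x^\ast\in B_{X^\ast}$ with $\|x_n^\ast\|\to\|x^\ast\|$. Here $B_{X^\ast}$ is the closed unit ball of the dual $X^\ast$. *)

theory Defs
  imports "HOL-Analysis.Analysis"
begin

text \<open>
  A Hausdorff quotient of \<open>K\<close> is represented by its equivalence relation \<open>E\<close> on \<open>topspace K\<close>; its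
  points are the equivalence classes and its canonical projection is \<open>\<lambda>x. E `` {x}\<close>.
\<close>

definition quotient_space :: "'a topology \<Rightarrow> ('a \<times> 'a) set \<Rightarrow> 'a set topology" where
  "quotient_space K E =
     topology (\<lambda>U. U \<subseteq> topspace K // E \<and> openin K {x \<in> topspace K. E `` {x} \<in> U})"

lemma openin_quotient_space:
  "openin (quotient_space K E) U \<longleftrightarrow>
     U \<subseteq> topspace K // E \<and> openin K {x \<in> topspace K. E `` {x} \<in> U}"
proof -
  have "istopology (\<lambda>U. U \<subseteq> topspace K // E \<and> openin K {x \<in> topspace K. E `` {x} \<in> U})"
    unfolding istopology_def
  proof (intro conjI allI impI)
    fix S T
    assume S: "S \<subseteq> topspace K // E \<and> openin K {x \<in> topspace K. E `` {x} \<in> S}"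
      and T: "T \<subseteq> topspace K // E \<and> openin K {x \<in> topspace K. E `` {x} \<in> T}"
    then show "S \<inter> T \<subseteq> topspace K // E"
      by blast
    have "{x \<in> topspace K. E `` {x} \<in> S \<inter> T}
        = {x \<in> topspace K. E `` {x} \<in> S} \<inter> {x \<in> topspace K. E `` {x} \<in> T}"
      by blast
    then show "openin K {x \<in> topspace K. E `` {x} \<in> S \<inter> T}"
      using S T by auto
  next
    fix \<U>
    assume U: "\<forall>S\<in>\<U>. S \<subseteq> topspace K // E \<and> openin K {x \<in> topspace K. E `` {x} \<in> S}"
    then show "\<Union>\<U> \<subseteq> topspace K // E"
      by blast
    have "{x \<in> topspace K. E `` {x} \<in> \<Union>\<U>} = (\<Union>S\<in>\<U>. {x \<in> topspace K. E `` {x} \<in> S})"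
      by blast
    then show "openin K {x \<in> topspace K. E `` {x} \<in> \<Union>\<U>}"
      using U by auto
  qed
  then show ?thesis
    by (simp add: quotient_space_def topology_inverse')
qed

lemma topspace_quotient_space [simp]: "topspace (quotient_space K E) = topspace K // E"
proof
  show "topspace (quotient_space K E) \<subseteq> topspace K // E"
    using openin_quotient_space openin_topspace by blast
  have "{x \<in> topspace K. E `` {x} \<in> topspace K // E} = topspace K"
    by (auto intro: quotientI)
  then show "topspace K // E \<subseteq> topspace (quotient_space K E)"
    by (intro openin_subset) (simp add: openin_quotient_space)
qed

lemma quotient_map_projection: "quotient_map K (quotient_space K E) (\<lambda>x. E `` {x})"
  unfolding quotient_map_def by (auto simp: openin_quotient_space quotient_def)

definition Quotients :: "'a topology \<Rightarrow> ('a \<times> 'a) set set" where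
  "Quotients K = {E. equiv (topspace K) E \<and> Hausdorff_space (quotient_space K E)}"

definition countable_weight_Quotients :: "'a topology \<Rightarrow> ('a \<times> 'a) set set" where
  "countable_weight_Quotients K = {E \<in> Quotients K. second_countable (quotient_space K E)}"

text \<open>\<open>natural_projection K E E' q\<close>: \<open>q\<close> maps the (larger) quotient by \<open>E\<close> onto the quotient by \<open>E'\<close>.\<close>

definition natural_projection ::
    "'a topology \<Rightarrow> ('a \<times> 'a) set \<Rightarrow> ('a \<times> 'a) set \<Rightarrow> ('a set \<Rightarrow> 'a set) \<Rightarrow> bool" where
  "natural_projection K E E' q \<longleftrightarrow>
     continuous_map (quotient_space K E) (quotient_space K E') q \<and>
     q ` topspace (quotient_space K E) = topspace (quotient_space K E') \<and>
     (\<forall>x\<in>topspace K. q (E `` {x}) = E' `` {x})"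

definition quotient_le ::
    "'a topology \<Rightarrow> ('a \<times> 'a) set \<Rightarrow> ('a \<times> 'a) set \<Rightarrow> bool" where
  "quotient_le K E' E \<longleftrightarrow> (\<exists>q. natural_projection K E E' q)"

lemma quotient_le_iff_subset:
  assumes "equiv (topspace K) E" "equiv (topspace K) E'"
  shows "quotient_le K E' E \<longleftrightarrow> E \<subseteq> E'"
proof
  assume "quotient_le K E' E"
  then obtain q where "natural_projection K E E' q"
    unfolding quotient_le_def by (elim exE)
  then have q: "q (E `` {x}) = E' `` {x}" if "x \<in> topspace K" for x
    using that by (simp add: natural_projection_def)
  show "E \<subseteq> E'"
  proof (clarify)
    fix x y assume "(x, y) \<in> E"
    then have "E `` {x} = E `` {y}" "x \<in> topspace K" "y \<in> topspace K"
      using equiv_class_eq[OF assms(1)] equiv_type[OF assms(1)] by blast+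
    then have "E' `` {x} = E' `` {y}"
      using q[of x] q[of y] by simp
    then show "(x, y) \<in> E'"
      by (rule eq_equiv_class[OF _ assms(2) \<open>y \<in> topspace K\<close>])
  qed
next
  assume sub: "E \<subseteq> E'"
  define q where "q C = E' `` C" for C
  have q: "q (E `` {x}) = E' `` {x}" if "x \<in> topspace K" for x
  proof -
    have "(x, x) \<in> E"
      using equiv_class_self[OF assms(1) that] by simp
    moreover have "z \<in> E' `` {x}" if "(x, y) \<in> E" "(y, z) \<in> E'" for y z
    proof -
      have "(x, y) \<in> E'" "trans E'"
        using that(1) sub assms(2) by (blast elim: equivE)+
      then show ?thesis
        using that(2) by (blast dest: transD)
    qed
    ultimately show ?thesis
      unfolding q_def by blast
  qed
  have "continuous_map K (quotient_space K E') (q \<circ> (\<lambda>x. E `` {x}))"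
    by (rule continuous_map_eq[OF quotient_imp_continuous_map[OF quotient_map_projection]])
      (simp add: q)
  then have "continuous_map (quotient_space K E) (quotient_space K E') q"
    by (simp add: continuous_compose_quotient_map_eq[OF quotient_map_projection])
  moreover have "q ` (topspace K // E) = topspace K // E'"
    using q by (simp add: quotient_def image_UN)
  ultimately show "quotient_le K E' E"
    unfolding quotient_le_def natural_projection_def by (intro exI[of _ q]) (simp add: q)
qed

definition is_quotient_sup ::
    "'a topology \<Rightarrow> ('a \<times> 'a) set set \<Rightarrow> ('a \<times> 'a) set \<Rightarrow> bool" where
  "is_quotient_sup K A E \<longleftrightarrow>
     E \<in> Quotients K \<and> (\<forall>E'\<in>A. quotient_le K E' E) \<and>
     (\<forall>F\<in>Quotients K. (\<forall>E'\<in>A. quotient_le K E' F) \<longrightarrow> quotient_le K E F)"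

definition cofinal_quotients :: "'a topology \<Rightarrow> ('a \<times> 'a) set set \<Rightarrow> bool" where
  "cofinal_quotients K S \<longleftrightarrow>
     S \<subseteq> countable_weight_Quotients K \<and>
     (\<forall>E\<in>countable_weight_Quotients K. \<exists>E'\<in>S. quotient_le K E E')"

definition sigma_semilattice :: "'a topology \<Rightarrow> ('a \<times> 'a) set set \<Rightarrow> bool" where
  "sigma_semilattice K S \<longleftrightarrow>
     S \<subseteq> countable_weight_Quotients K \<and>
     (\<forall>A. A \<subseteq> S \<and> countable A \<longrightarrow> (\<exists>E\<in>S. is_quotient_sup K A E))"

definition map_fiber_convergent ::
    "'a topology \<Rightarrow> 'b topology \<Rightarrow> ('a \<Rightarrow> 'b) \<Rightarrow> (nat \<Rightarrow> 'b) \<Rightarrow> 'b \<Rightarrow> bool" where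
  "map_fiber_convergent M N \<pi> s x \<longleftrightarrow>
     continuous_map M N \<pi> \<and> \<pi> ` topspace M = topspace N \<and>
     range s \<subseteq> topspace N \<and> limitin N s x sequentially \<and>
     (\<forall>y\<in>topspace M. \<pi> y = x \<longrightarrow>
        (\<exists>t. (\<forall>n. t n \<in> topspace M \<and> \<pi> (t n) = s n) \<and> limitin M t y sequentially))"

definition fiber_convergent :: "'a topology \<Rightarrow> (nat \<Rightarrow> 'a) \<Rightarrow> bool" where
  "fiber_convergent K s \<longleftrightarrow>
     compact_space K \<and> Hausdorff_space K \<and> \<not> second_countable K \<and> range s \<subseteq> topspace K \<and>
     (\<exists>x. limitin K s x sequentially \<and>
       (\<exists>S. cofinal_quotients K S \<and> sigma_semilattice K S \<and>
         (\<forall>E'\<in>S. \<forall>E\<in>S. quotient_le K E' E \<longrightarrow>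
           (\<forall>\<pi>. natural_projection K E E' \<pi> \<longrightarrow>
             map_fiber_convergent (quotient_space K E) (quotient_space K E') \<pi>
               (\<lambda>n. E' `` {s n}) (E' `` {x})))))"

text \<open>
  On the dual \<open>'a \<Rightarrow>\<^sub>L real\<close> the strong operator topology is the topology of pointwise convergence,
  i.e. the weak* topology.
\<close>

definition weak_star_dual_ball :: "('a::real_normed_vector \<Rightarrow>\<^sub>L real) topology" where
  "weak_star_dual_ball = subtopology strong_operator_topology (cball 0 1)"

definition class_E0 :: "'a::banach itself \<Rightarrow> bool" where
  "class_E0 _ \<longleftrightarrow>
     \<not> separable_space (euclidean :: 'a topology) \<and>
     (\<forall>s :: nat \<Rightarrow> 'a \<Rightarrow>\<^sub>L real. range s \<subseteq> cball 0 1 \<longrightarrow>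
        (fiber_convergent weak_star_dual_ball s \<longleftrightarrow>
         (\<exists>x\<in>cball 0 1. limitin weak_star_dual_ball s x sequentially \<and>
            (\<lambda>n. norm (s n)) \<longlonglongrightarrow> norm x)))"

end

theory Submission
  imports Defs
begin

text \<open>
  Fiber convergence is a purely topological notion: a homeomorphism \<open>f : K \<rightarrow> L\<close> carries equivalence
  relations on \<open>K\<close> to equivalence relations on \<open>L\<close>, compatibly with quotients, their order, suprema
  and natural projections. So \<open>f\<close> maps fiber convergent sequences to fiber convergent sequences, and in
  the class \<open>\<E>\<^sub>0\<close> these are the sequences whose norms converge to the norm of the limit.
\<close>

section \<open>Transporting equivalence relations along a homeomorphism\<close>

text \<open>The direct image under \<open>f\<close> on pairs is automatically monotone for
  inclusion, hence compatible with the reversed order of quotients. It is only applied to maps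
  injective on the carrier.\<close>

definition transport :: "('a \<Rightarrow> 'b) \<Rightarrow> ('a \<times> 'a) set \<Rightarrow> ('b \<times> 'b) set" where
  "transport f E = map_prod f f ` E"

lemma transport_mono: "E \<subseteq> F \<Longrightarrow> transport f E \<subseteq> transport f F"
  unfolding transport_def by blast

text \<open>\<open>g\<close> undoes \<open>f\<close> only on \<open>topspace K\<close>, so
  \<open>E\<close> has to live there. Used in both directions, this makes \<open>transport f\<close>
  and \<open>transport g\<close> mutually inverse, and inclusions can be pulled back as well as
  pushed forward.\<close>

lemma transport_transport:
  assumes "homeomorphic_maps K L f g" "E \<subseteq> topspace K \<times> topspace K"
  shows "transport g (transport f E) = E"
proof -
  have "map_prod g g (map_prod f f p) = p" if "p \<in> E" for p
    using assms that by (cases p) (auto simp: homeomorphic_maps_def)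
  then show ?thesis
    unfolding transport_def image_image by simp
qed

text \<open>Injectivity of \<open>f\<close> on \<open>topspace K\<close> ensures that a pair of
  \<open>transport f E\<close> starting at \<open>f x\<close> comes from a pair of \<open>E\<close>
  starting at \<open>x\<close>. Hence \<open>image f\<close> is the map that \<open>f\<close>
  induces on classes.\<close>

lemma Image_transport:
  assumes "homeomorphic_maps K L f g" "E \<subseteq> topspace K \<times> topspace K" "x \<in> topspace K"
  shows "transport f E `` {f x} = f ` (E `` {x})"
proof -
  have "a = x" if "a \<in> topspace K" "f a = f x" for a
    using assms that by (metis homeomorphic_maps_def)
  then show ?thesis
    using assms(2) by (fastforce simp: transport_def)
qed

lemma equiv_transport:
  assumes fg: "homeomorphic_maps K L f g" and E: "equiv (topspace K) E"
  shows "equiv (topspace L) (transport f E)"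
proof -
  have f: "f ` topspace K = topspace L"
    using fg by (simp add: homeomorphic_imp_surjective_map homeomorphic_maps_map)
  have inj: "inj_on f (topspace K)"
    using fg homeomorphic_imp_injective_map homeomorphic_maps_map by metis
  have sub: "E \<subseteq> topspace K \<times> topspace K"
    using E by (rule equiv_type)
  show ?thesis
  proof (rule equivI)
    show "transport f E \<subseteq> topspace L \<times> topspace L"
      using sub f unfolding transport_def by auto
    show "refl_on (topspace L) (transport f E)"
      using E unfolding transport_def f[symmetric]
      by (auto simp: refl_on_def elim!: equivE intro: rev_image_eqI)
    show "sym (transport f E)"
      using E unfolding transport_def
      by (auto simp: sym_def elim!: equivE intro: rev_image_eqI)
    show "trans (transport f E)"
    proof (rule transI)
      fix u v w assume "(u, v) \<in> transport f E" "(v, w) \<in> transport f E"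
      then obtain a b c d where "(a, b) \<in> E" "(c, d) \<in> E" "u = f a" "w = f d" "f b = f c"
        unfolding transport_def by auto
      \<comment> \<open>The two pairs meet only after applying \<open>f\<close>; injectivity makes
        their preimages composable in \<open>E\<close>.\<close>
      moreover from this have "b = c"
        using inj sub by (auto dest: inj_onD)
      ultimately show "(u, w) \<in> transport f E"
        using E unfolding transport_def by (auto elim!: equivE dest: transD intro: rev_image_eqI)
    qed
  qed
qed

section \<open>Induced homeomorphisms of quotient spaces\<close>

text \<open>By the universal property of the quotient map, continuity may be tested after composing
  with the projection of \<open>K\<close>. By \<open>Image_transport\<close> this composite is
  \<open>f\<close> followed by the projection of \<open>L\<close>.\<close>

lemma continuous_map_transport:
  assumes fg: "homeomorphic_maps K L f g" and E: "equiv (topspace K) E"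
  shows "continuous_map (quotient_space K E) (quotient_space L (transport f E)) (image f)"
proof -
  have "continuous_map K (quotient_space L (transport f E)) ((\<lambda>y. transport f E `` {y}) \<circ> f)"
    using fg quotient_imp_continuous_map[OF quotient_map_projection]
    by (intro continuous_map_compose) (auto simp: homeomorphic_maps_def)
  then have "continuous_map K (quotient_space L (transport f E)) (image f \<circ> (\<lambda>x. E `` {x}))"
    by (rule continuous_map_eq) (simp add: Image_transport[OF fg equiv_type[OF E]])
  then show ?thesis
    by (simp add: continuous_compose_quotient_map_eq[OF quotient_map_projection])
qed

lemma homeomorphic_maps_transport:
  assumes fg: "homeomorphic_maps K L f g" and E: "equiv (topspace K) E"
  shows "homeomorphic_maps (quotient_space K E) (quotient_space L (transport f E)) (image f) (image g)"
proof -
  \<comment> \<open>Stated for arbitrary spaces and maps because both composites of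
    \<open>image f\<close> and \<open>image g\<close> must be the identity on classes.\<close>
  have inv: "g ` f ` C = C" if "homeomorphic_maps K' L' f g" "C \<subseteq> topspace K'"
    for K' :: "'x topology" and L' :: "'y topology" and f g C
    using that unfolding homeomorphic_maps_def image_image by (auto simp: subset_iff image_iff)
  have gf: "homeomorphic_maps L K g f"
    using fg by (rule homeomorphic_maps_sym[THEN iffD1])
  have E': "equiv (topspace L) (transport f E)"
    using fg E by (rule equiv_transport)
  \<comment> \<open>The previous lemma for \<open>g\<close> lands in the quotient by
    \<open>transport g (transport f E)\<close>, which is \<open>E\<close> again.\<close>
  have "continuous_map (quotient_space L (transport f E)) (quotient_space K E) (image g)"
    using continuous_map_transport[OF gf E'] by (simp add: transport_transport[OF fg equiv_type[OF E]])
  then show ?thesis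
    using continuous_map_transport[OF fg E] inv[OF fg] inv[OF gf]
      in_quotient_imp_subset[OF E] in_quotient_imp_subset[OF E']
    by (simp add: homeomorphic_maps_def)
qed

lemma transport_Quotients:
  assumes fg: "homeomorphic_maps K L f g" and E: "E \<in> Quotients K"
  shows "transport f E \<in> Quotients L"
proof -
  have eq: "equiv (topspace K) E"
    using E by (simp add: Quotients_def)
  then have "quotient_space K E homeomorphic_space quotient_space L (transport f E)"
    using homeomorphic_maps_transport[OF fg] unfolding homeomorphic_space_def by blast
  then show ?thesis
    using E equiv_transport[OF fg eq] by (simp add: Quotients_def homeomorphic_Hausdorff_space)
qed

lemma transport_countable_weight_Quotients:
  assumes fg: "homeomorphic_maps K L f g" and E: "E \<in> countable_weight_Quotients K"
  shows "transport f E \<in> countable_weight_Quotients L"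
proof -
  have Q: "E \<in> Quotients K"
    using E by (simp add: countable_weight_Quotients_def)
  then have "quotient_space K E homeomorphic_space quotient_space L (transport f E)"
    using homeomorphic_maps_transport[OF fg] unfolding homeomorphic_space_def Quotients_def by blast
  then show ?thesis
    using E transport_Quotients[OF fg Q]
    by (simp add: countable_weight_Quotients_def homeomorphic_space_second_countability)
qed

section \<open>Order, suprema, cofinality and semilattices\<close>

lemma quotient_le_Quotients:
  "\<lbrakk>E \<in> Quotients K; E' \<in> Quotients K\<rbrakk> \<Longrightarrow> quotient_le K E' E \<longleftrightarrow> E \<subseteq> E'"
  by (simp add: Quotients_def quotient_le_iff_subset)

text \<open>\<open>transport f\<close> is an order isomorphism from \<open>Quotients K\<close> onto
  \<open>Quotients L\<close> with inverse \<open>transport g\<close>, and order isomorphisms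
  preserve suprema.\<close>

lemma is_quotient_sup_transport:
  assumes fg: "homeomorphic_maps K L f g" and A: "A \<subseteq> Quotients K" and sup: "is_quotient_sup K A E"
  shows "is_quotient_sup L (transport f ` A) (transport f E)"
  unfolding is_quotient_sup_def
proof (intro conjI ballI impI)
  have gf: "homeomorphic_maps L K g f"
    using fg by (rule homeomorphic_maps_sym[THEN iffD1])
  have E: "E \<in> Quotients K"
    using sup by (simp add: is_quotient_sup_def)
  show Q: "transport f E \<in> Quotients L"
    using fg E by (rule transport_Quotients)
  show "quotient_le L E' (transport f E)" if E': "E' \<in> transport f ` A" for E'
  proof -
    obtain D where D: "D \<in> A" "E' = transport f D"
      using E' by blast
    have "quotient_le K D E"
      using sup D by (simp add: is_quotient_sup_def)
    moreover have "D \<in> Quotients K"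
      using A D by blast
    ultimately have "E \<subseteq> D"
      using E by (simp add: quotient_le_Quotients)
    then have "transport f E \<subseteq> E'"
      unfolding D(2) by (rule transport_mono)
    moreover have "E' \<in> Quotients L"
      using D A transport_Quotients[OF fg] by blast
    ultimately show ?thesis
      using Q by (simp add: quotient_le_Quotients)
  qed
  show "quotient_le L (transport f E) F"
    if F: "F \<in> Quotients L" and le: "\<forall>E'\<in>transport f ` A. quotient_le L E' F" for F
  proof -
    \<comment> \<open>The upper bound \<open>F\<close> is pulled back to \<open>K\<close>, compared
      there with the supremum \<open>E\<close>, and the resulting inclusion is pushed forward
      again.\<close>
    have QF: "transport g F \<in> Quotients K"
      using gf F by (rule transport_Quotients)
    have "quotient_le K D (transport g F)" if "D \<in> A" for D
    proof -
      have D: "D \<in> Quotients K"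
        using A that by blast
      have "quotient_le L (transport f D) F"
        using le that by blast
      then have "F \<subseteq> transport f D"
        using F transport_Quotients[OF fg D] by (simp add: quotient_le_Quotients)
      then have "transport g F \<subseteq> transport g (transport f D)"
        by (rule transport_mono)
      also have "\<dots> = D"
        using D by (intro transport_transport[OF fg] equiv_type) (simp add: Quotients_def)
      finally show ?thesis
        using D QF by (simp add: quotient_le_Quotients)
    qed
    then have "transport g F \<subseteq> E"
      using sup QF E by (simp add: is_quotient_sup_def quotient_le_Quotients)
    then have "transport f (transport g F) \<subseteq> transport f E"
      by (rule transport_mono)
    moreover have "transport f (transport g F) = F"
      using F by (intro transport_transport[OF gf] equiv_type) (simp add: Quotients_def)
    ultimately show ?thesis
      using F Q by (simp add: quotient_le_Quotients)
  qed
qed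

text \<open>A quotient \<open>F\<close> of \<open>L\<close> is pulled back to \<open>K\<close>,
  dominated there by a member of \<open>S\<close>, and that member is pushed forward to dominate
  \<open>F\<close>.\<close>

lemma cofinal_quotients_transport:
  assumes fg: "homeomorphic_maps K L f g" and S: "cofinal_quotients K S"
  shows "cofinal_quotients L (transport f ` S)"
  unfolding cofinal_quotients_def
proof (intro conjI ballI)
  have gf: "homeomorphic_maps L K g f"
    using fg by (rule homeomorphic_maps_sym[THEN iffD1])
  show "transport f ` S \<subseteq> countable_weight_Quotients L"
    using S transport_countable_weight_Quotients[OF fg] by (auto simp: cofinal_quotients_def)
  show "\<exists>E'\<in>transport f ` S. quotient_le L F E'" if F: "F \<in> countable_weight_Quotients L" for F
  proof -
    have gF: "transport g F \<in> countable_weight_Quotients K"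
      using gf F by (rule transport_countable_weight_Quotients)
    then obtain E where E: "E \<in> S" "quotient_le K (transport g F) E"
      using S by (auto simp: cofinal_quotients_def)
    have Q: "E \<in> Quotients K" "F \<in> Quotients L" "transport g F \<in> Quotients K"
      using E S F gF by (auto simp: cofinal_quotients_def countable_weight_Quotients_def)
    then have "E \<subseteq> transport g F"
      using E by (simp add: quotient_le_Quotients)
    then have "transport f E \<subseteq> transport f (transport g F)"
      by (rule transport_mono)
    also have "\<dots> = F"
      using Q by (intro transport_transport[OF gf] equiv_type) (simp add: Quotients_def)
    finally have "quotient_le L F (transport f E)"
      using Q transport_Quotients[OF fg Q(1)] by (simp add: quotient_le_Quotients)
    then show ?thesis
      using E by blast
  qed
qed

lemma sigma_semilattice_transport:
  assumes fg: "homeomorphic_maps K L f g" and S: "sigma_semilattice K S"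
  shows "sigma_semilattice L (transport f ` S)"
  unfolding sigma_semilattice_def
proof (intro conjI allI impI)
  show "transport f ` S \<subseteq> countable_weight_Quotients L"
    using S transport_countable_weight_Quotients[OF fg] by (auto simp: sigma_semilattice_def)
  show "\<exists>E\<in>transport f ` S. is_quotient_sup L B E" if B: "B \<subseteq> transport f ` S \<and> countable B" for B
  proof -
    \<comment> \<open>A countable subset of an image is the image of a countable subset, so the
      closure property of \<open>S\<close> applies to \<open>A\<close>.\<close>
    obtain A where A: "A \<subseteq> S" "countable A" "B = transport f ` A"
      using B countable_subset_image[of B "transport f" S] by blast
    then obtain E where "E \<in> S" "is_quotient_sup K A E"
      using S by (auto simp: sigma_semilattice_def)
    moreover have "A \<subseteq> Quotients K"
      using A S by (auto simp: sigma_semilattice_def countable_weight_Quotients_def)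
    ultimately show ?thesis
      using is_quotient_sup_transport[OF fg] A by blast
  qed
qed

section \<open>Invariance of fiber convergence\<close>

text \<open>The maps form a commutative square with homeomorphisms \<open>a\<close> and
  \<open>b\<close> joining \<open>p\<close> to \<open>p'\<close>. A point over \<open>b x\<close> is
  moved back by \<open>a'\<close>, approximated in the fibers of \<open>p\<close>, and the lifted
  sequence is moved forward by \<open>a\<close>.\<close>

lemma map_fiber_convergent_homeomorphic:
  assumes a: "homeomorphic_maps M M' a a'" and b: "homeomorphic_maps N N' b b'"
    and conv: "map_fiber_convergent M N p s x"
    and p': "continuous_map M' N' p'"
    and comm: "\<And>m. m \<in> topspace M \<Longrightarrow> p' (a m) = b (p m)"
  shows "map_fiber_convergent M' N' p' (\<lambda>n. b (s n)) (b x)"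
  unfolding map_fiber_convergent_def
proof (intro conjI ballI impI)
  have p: "p ` topspace M = topspace N" and s: "range s \<subseteq> topspace N" and lim: "limitin N s x sequentially"
    using conv by (auto simp: map_fiber_convergent_def)
  have ca: "continuous_map M M' a" and ca': "continuous_map M' M a'" and cb: "continuous_map N N' b"
    using a b by (auto simp: homeomorphic_maps_def)
  have sa: "a ` topspace M = topspace M'" and sb: "b ` topspace N = topspace N'"
    using a b by (simp_all add: homeomorphic_imp_surjective_map homeomorphic_maps_map)
  show "continuous_map M' N' p'"
    by (rule p')
  show "p' ` topspace M' = topspace N'"
    unfolding sa[symmetric] sb[symmetric] p[symmetric] image_image using comm by simp
  show "range (\<lambda>n. b (s n)) \<subseteq> topspace N'"
    using s sb by auto
  show "limitin N' (\<lambda>n. b (s n)) (b x) sequentially"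
    using continuous_map_limit[OF cb lim] by (simp add: comp_def)
  show "\<exists>t. (\<forall>n. t n \<in> topspace M' \<and> p' (t n) = b (s n)) \<and> limitin M' t y sequentially"
    if y: "y \<in> topspace M'" "p' y = b x" for y
  proof -
    have a'y: "a' y \<in> topspace M" "a (a' y) = y"
      using y a ca' by (auto simp: homeomorphic_maps_def continuous_map_def)
    \<comment> \<open>Injectivity of \<open>b\<close> on \<open>topspace N\<close> will turn this
      into the statement that \<open>a' y\<close> lies in the fiber of \<open>p\<close> over
      \<open>x\<close>.\<close>
    have "b (p (a' y)) = b x"
      using comm a'y y by metis
    moreover have "p (a' y) \<in> topspace N" "x \<in> topspace N"
      using p a'y limitin_topspace[OF lim] by auto
    ultimately have "p (a' y) = x"
      using b by (metis homeomorphic_maps_def)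
    then obtain t where t: "\<And>n. t n \<in> topspace M" "\<And>n. p (t n) = s n" "limitin M t (a' y) sequentially"
      using conv a'y unfolding map_fiber_convergent_def by blast
    have "limitin M' (\<lambda>n. a (t n)) y sequentially"
      using continuous_map_limit[OF ca t(3)] a'y by (simp add: comp_def)
    then show ?thesis
      using t sa comm by (intro exI[of _ "\<lambda>n. a (t n)"]) auto
  qed
qed

text \<open>If \<open>S\<close> witnesses fiber convergence in \<open>K\<close>, then
  \<open>transport f\<close> applied to its members gives a witness in \<open>L\<close>: each
  natural projection there is conjugate to one in \<open>K\<close>.\<close>

lemma fiber_convergent_homeomorphic:
  assumes fg: "homeomorphic_maps K L f g" and s: "fiber_convergent K s"
  shows "fiber_convergent L (\<lambda>n. f (s n))"
proof -
  have hs: "K homeomorphic_space L"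
    using fg unfolding homeomorphic_space_def by blast
  have cf: "continuous_map K L f"
    using fg by (simp add: homeomorphic_maps_def)
  have top: "s n \<in> topspace K" for n
    using s by (auto simp: fiber_convergent_def)
  obtain x S where lim: "limitin K s x sequentially"
    and S: "cofinal_quotients K S" "sigma_semilattice K S"
    and conv: "\<And>E E' \<pi>. \<lbrakk>E' \<in> S; E \<in> S; quotient_le K E' E; natural_projection K E E' \<pi>\<rbrakk> \<Longrightarrow>
      map_fiber_convergent (quotient_space K E) (quotient_space K E') \<pi> (\<lambda>n. E' `` {s n}) (E' `` {x})"
    using s unfolding fiber_convergent_def by blast
  have x: "x \<in> topspace K"
    using lim by (rule limitin_topspace)
  have "map_fiber_convergent (quotient_space L (transport f E)) (quotient_space L (transport f E')) \<pi>
          (\<lambda>n. transport f E' `` {f (s n)}) (transport f E' `` {f x})"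
    if E: "E \<in> S" and E': "E' \<in> S" and \<pi>: "natural_projection L (transport f E) (transport f E') \<pi>"
    for E E' \<pi>
  proof -
    have Q: "E \<in> Quotients K" "E' \<in> Quotients K"
      using E E' S by (auto simp: cofinal_quotients_def countable_weight_Quotients_def)
    then have eq: "equiv (topspace K) E" "equiv (topspace K) E'"
      by (simp_all add: Quotients_def)
    \<comment> \<open>The projection \<pi> itself witnesses the order between the transported
      quotients; pulling it back by \<open>transport g\<close> makes the hypothesis on
      \<open>S\<close> available for \<open>E\<close> and \<open>E'\<close>.\<close>
    have "transport f E \<subseteq> transport f E'"
      using \<pi> Q transport_Quotients[OF fg] quotient_le_Quotients unfolding quotient_le_def by metis
    then have "transport g (transport f E) \<subseteq> transport g (transport f E')"
      by (rule transport_mono)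
    then have "E \<subseteq> E'"
      by (simp add: transport_transport[OF fg] equiv_type eq)
    then have le: "quotient_le K E' E"
      using Q by (simp add: quotient_le_Quotients)
    then obtain q where q: "natural_projection K E E' q"
      unfolding quotient_le_def by blast
    \<comment> \<open>Although \<pi> is arbitrary, its values on classes are forced: both sides are
      the class of \<open>f z\<close> for any \<open>z\<close> representing \<open>C\<close>. This
      is the commuting square needed for the transfer.\<close>
    have "\<pi> (f ` C) = f ` q C" if "C \<in> topspace (quotient_space K E)" for C
    proof -
      obtain z where z: "z \<in> topspace K" "C = E `` {z}"
        using \<open>C \<in> topspace (quotient_space K E)\<close> by (auto elim: quotientE)
      have "f z \<in> topspace L"
        using z cf by (auto simp: continuous_map_def)
      then have "\<pi> (transport f E `` {f z}) = transport f E' `` {f z}"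
        using \<pi> by (simp add: natural_projection_def)
      moreover have "q (E `` {z}) = E' `` {z}"
        using q z by (simp add: natural_projection_def)
      ultimately show ?thesis
        using z by (simp add: Image_transport[OF fg] equiv_type eq)
    qed
    moreover have "continuous_map (quotient_space L (transport f E)) (quotient_space L (transport f E')) \<pi>"
      using \<pi> by (simp add: natural_projection_def)
    ultimately have "map_fiber_convergent (quotient_space L (transport f E))
        (quotient_space L (transport f E')) \<pi> (\<lambda>n. f ` (E' `` {s n})) (f ` (E' `` {x}))"
      by (intro map_fiber_convergent_homeomorphic[OF homeomorphic_maps_transport[OF fg eq(1)]
            homeomorphic_maps_transport[OF fg eq(2)] conv[OF E' E le q]])
    then show ?thesis
      by (simp add: Image_transport[OF fg] equiv_type eq top x)
  qed
  then have "\<forall>E'\<in>transport f ` S. \<forall>E\<in>transport f ` S. quotient_le L E' E \<longrightarrow>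
      (\<forall>\<pi>. natural_projection L E E' \<pi> \<longrightarrow> map_fiber_convergent (quotient_space L E)
        (quotient_space L E') \<pi> (\<lambda>n. E' `` {f (s n)}) (E' `` {f x}))"
    by blast
  moreover have "limitin L (\<lambda>n. f (s n)) (f x) sequentially"
    using continuous_map_limit[OF cf lim] by (simp add: comp_def)
  moreover have "range (\<lambda>n. f (s n)) \<subseteq> topspace L"
    using top cf by (auto simp: continuous_map_def)
  moreover have "compact_space L" "Hausdorff_space L" "\<not> second_countable L"
    using s hs by (simp_all add: fiber_convergent_def homeomorphic_compact_space
        homeomorphic_Hausdorff_space homeomorphic_space_second_countability)
  ultimately show ?thesis
    using cofinal_quotients_transport[OF fg S(1)] sigma_semilattice_transport[OF fg S(2)]
    unfolding fiber_convergent_def by blast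
qed

section \<open>Application to dual balls\<close>

lemma topspace_weak_star_dual_ball: "topspace weak_star_dual_ball = cball 0 1"
  by (simp add: weak_star_dual_ball_def strong_operator_topology_topspace)

theorem theorem3:
  fixes f :: "('a::banach \<Rightarrow>\<^sub>L real) \<Rightarrow> ('b::banach \<Rightarrow>\<^sub>L real)"
    and s :: "nat \<Rightarrow> 'a \<Rightarrow>\<^sub>L real" and x :: "'a \<Rightarrow>\<^sub>L real"
  assumes "class_E0 TYPE('a)" and "class_E0 TYPE('b)"
    and "homeomorphic_map weak_star_dual_ball weak_star_dual_ball f"
    and "range s \<subseteq> cball 0 1"
    and "limitin weak_star_dual_ball s x sequentially"
    and "(\<lambda>n. norm (s n)) \<longlonglongrightarrow> norm x"
  shows "(\<lambda>n. norm (f (s n))) \<longlonglongrightarrow> norm (f x)"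
proof -
  obtain g where fg: "homeomorphic_maps weak_star_dual_ball weak_star_dual_ball f g"
    using assms(3) by (auto simp: homeomorphic_map_maps)
  then have cf: "continuous_map weak_star_dual_ball weak_star_dual_ball f"
    by (simp add: homeomorphic_maps_def)
  have "x \<in> cball 0 1"
    using limitin_topspace[OF assms(5)] unfolding topspace_weak_star_dual_ball .
  then have "fiber_convergent weak_star_dual_ball s"
    using assms(1,4,5,6) unfolding class_E0_def by blast
  with fg have fc: "fiber_convergent weak_star_dual_ball (\<lambda>n. f (s n))"
    by (rule fiber_convergent_homeomorphic)
  then have "range (\<lambda>n. f (s n)) \<subseteq> cball 0 1"
    unfolding fiber_convergent_def topspace_weak_star_dual_ball by blast
  \<comment> \<open>Membership in the class only yields some weak* limit \<open>y\<close> to whose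
    norm the norms converge; it still has to be identified with \<open>f x\<close>.\<close>
  then obtain y where y: "limitin weak_star_dual_ball (\<lambda>n. f (s n)) y sequentially"
      "(\<lambda>n. norm (f (s n))) \<longlonglongrightarrow> norm y"
    using assms(2) fc unfolding class_E0_def by blast
  have "limitin weak_star_dual_ball (\<lambda>n. f (s n)) (f x) sequentially"
    using continuous_map_limit[OF cf assms(5)] by (simp add: comp_def)
  \<comment> \<open>Limits are unique because the fiber convergence \<open>fc\<close> includes the
    Hausdorff property of the ball.\<close>
  then have "y = f x"
    using y(1) fc by (intro limitin_Hausdorff_unique) (auto simp: fiber_convergent_def)
  then show ?thesis
    using y(2) by simp
qed

end
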